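(* Let $p\ge 1$. For every $t\ge 0$ let $0<m_t\le L_t$, $\sigma_t\ge 0$, $0<\delta_t<\frac{2m_t}{L_t+m_t}$, $0\le\alpha_t\le\frac{2}{(1+\delta_t)L_t}$, and let $f_t\in\mathcal S(m_t,L_t)$ with global minimizer $x_t^*\in\mathbb R^p$. Consider the inexact online gradient descent iteration $x_{t+1}=x_t-\alpha_t(\nabla f_t(x_t)+v_t)$ and assume $\|x_{t+1}^*-x_t^*\|\le\sigma_t$ and $\|v_t\|\le\delta_t\|\nabla f_t(x_t)\|$ for all $t$. Let $\mathcal T_t\subseteq\mathbb R_+^4$ be the set of tuples of non-negative scalars $(\rho_t,\lambda_t^{(1)},\lambda_t^{(2)},\lambda_t^{(3)})$ satisfying $$\begin{bmatrix}1-\rho_t^2-2\lambda_t^{(1)}L_tm_t & -\alpha_t+\lambda_t^{(1)}(L_t+m_t) & 1 & -\alpha_t\\ -\alpha_t+\lambda_t^{(1)}(L_t+m_t) & \alpha_t^2-2\lambda_t^{(1)}+\delta_t^2\lambda_t^{(3)} & -\alpha_t & \alpha_t^2\\ 1 & -\alpha_t & 1-\lambda_t^{(2)} & -\alpha_t\\ -\alpha_t & \alpha_t^2 & -\alpha_t & \alpha_t^2-\lambda_t^{(3)}\end{bmatrix}\preceq 0.$$ Let $\hat U_0=\|x_0-x_0^*\|^2$ and, for $t\ge0$, $$\hat U_{t+1}=\inf_{(\rho_t,\lambda_t^{(1)},\lambda_t^{(2)},\lambda_t^{(3)})\in\mathcal T_t}\left(\rho_t^2\hat U_t+\lambda_t^{(2)}\sigma_t^2\right).$$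 Then for all $t\ge0$, $\hat U_{t+1}=\left(\hat\rho_t\sqrt{\hat U_t}+\sigma_t\right)^2$, where $$\hat\rho_t:=\begin{cases}1-\alpha_tm_t(1-\delta_t)&\text{if }0\le\alpha_t\le\alpha_{t_-},\\[2pt] \left(1-\frac{2\alpha_tL_tm_t}{L_t+m_t}+\frac{\alpha_t\delta_t^2(L_t+m_t-2\alpha_tL_tm_t)}{2-\alpha_t(L_t+m_t)}\right)^{1/2}&\text{if }\alpha_{t_-}<\alpha_t<\alpha_{t_+},\\[2pt] (1+\delta_t)\alpha_tL_t-1&\text{if }\alpha_{t_+}\le\alpha_t\le\frac{2}{(1+\delta_t)L_t},\end{cases}$$ with $\alpha_{t_-}:=\frac{1}{1-\delta_t}\left(\frac{2}{L_t+m_t}-\frac{\delta_t}{m_t}\right)$ and $\alpha_{t_+}:=\frac{1}{1+\delta_t}\left(\frac{2}{L_t+m_t}+\frac{\delta_t}{L_t}\right)$.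
   Context: $\mathcal S(m,L)$ is the set of differentiable functions $f:\mathbb R^p\to\mathbb R$ having a unique global minimizer $x^*$ such that for all $x\in\mathbb R^p$ $$\begin{bmatrix}x-x^*\\ \nabla f(x)\end{bmatrix}^T\begin{bmatrix}-2mLI_p&(L+m)I_p\\(L+m)I_p&-2I_p\end{bmatrix}\begin{bmatrix}x-x^*\\ \nabla f(x)\end{bmatrix}\ge0.$$ $P\preceq0$ means the symmetric matrix $P$ is negative semidefinite; norms are Euclidean. *)

theory Defs
  imports "HOL-Analysis.Analysis"
begin

definition gradient :: "('a::real_inner \<Rightarrow> real) \<Rightarrow> 'a \<Rightarrow> 'a"
  where "gradient f x = (THE D. GDERIV f x :> D)"

lemma gradient_eq:
  fixes f :: "'a::real_inner \<Rightarrow> real"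
  assumes "GDERIV f x :> D"
  shows "gradient f x = D"
  unfolding gradient_def
proof (rule the_equality)
  show "GDERIV f x :> D" by (fact assms)
next
  fix D' assume "GDERIV f x :> D'"
  with assms have "(\<lambda>h. inner h D') = (\<lambda>h. inner h D)"
    unfolding gderiv_def by (blast intro: has_derivative_unique)
  then have "inner h D' = inner h D" for h
    by (rule fun_cong)
  then show "D' = D"
    by (rule vector_eq_ldot[THEN iffD1, OF allI])
qed

lemma gderiv_gradient:
  fixes f :: "'a::euclidean_space \<Rightarrow> real"
  assumes "f differentiable at x"
  shows "GDERIV f x :> gradient f x"
proof -
  obtain f' where f': "(f has_derivative f') (at x)"
    using assms by (auto simp: differentiable_def)
  then interpret linear f' by (rule has_derivative_linear)
  define D where "D = (\<Sum>b\<in>Basis. f' b *\<^sub>R b)"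
  have "f' h = h \<bullet> D" for h
  proof -
    have "f' h = f' (\<Sum>b\<in>Basis. (h \<bullet> b) *\<^sub>R b)"
      by (simp add: euclidean_representation)
    also have "\<dots> = h \<bullet> D"
      by (simp add: D_def sum scaleR inner_sum_right mult.commute)
    finally show ?thesis .
  qed
  then have "f' = (\<lambda>h. h \<bullet> D)" by (rule ext)
  with f' have "GDERIV f x :> D"
    by (simp only: gderiv_def)
  then show ?thesis
    by (simp add: gradient_eq[of f x D])
qed

abbreviation global_minimizer :: "('a \<Rightarrow> real) \<Rightarrow> 'a \<Rightarrow> bool"
  where "global_minimizer f z \<equiv> is_arg_min f (\<lambda>_. True) z"

definition block_mat ::
  "real^'p^'p \<Rightarrow> real^'p^'p \<Rightarrow> real^'p^'p \<Rightarrow> real^'p^'p \<Rightarrow> real^('p + 'p)^('p + 'p)"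
  where "block_mat A B C D = (\<chi> i j. case (i, j) of
     (Inl a, Inl b) \<Rightarrow> A $ a $ b | (Inl a, Inr b) \<Rightarrow> B $ a $ b
   | (Inr a, Inl b) \<Rightarrow> C $ a $ b | (Inr a, Inr b) \<Rightarrow> D $ a $ b)"

definition block_vec :: "real^'p \<Rightarrow> real^'p \<Rightarrow> real^('p + 'p)"
  where "block_vec x y = (\<chi> i. case i of Inl a \<Rightarrow> x $ a | Inr b \<Rightarrow> y $ b)"

definition sector_mat :: "real \<Rightarrow> real \<Rightarrow> real^('p + 'p)^('p::finite + 'p)"
  where "sector_mat m L = block_mat (mat (- 2 * m * L)) (mat (L + m)) (mat (L + m)) (mat (- 2))"

definition S_class :: "real \<Rightarrow> real \<Rightarrow> (real^'p::finite \<Rightarrow> real) set"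
  where "S_class m L = {f. (\<forall>x. f differentiable (at x)) \<and> (\<exists>!z. global_minimizer f z) \<and>
     (\<forall>z. global_minimizer f z \<longrightarrow>
        (\<forall>x. block_vec (x - z) (gradient f x) \<bullet>
             (sector_mat m L *v block_vec (x - z) (gradient f x)) \<ge> 0))}"

lemma sum_UNIV_Plus:
  fixes h :: "'p::finite + 'p \<Rightarrow> real"
  shows "(\<Sum>i\<in>UNIV. h i) = (\<Sum>a\<in>UNIV. h (Inl a)) + (\<Sum>b\<in>UNIV. h (Inr b))"
  by (subst UNIV_Plus_UNIV[symmetric], subst sum.Plus) (simp_all only: finite o_def)

lemma inner_block_vec:
  fixes x y x' y' :: "real^'p::finite"
  shows "block_vec x y \<bullet> block_vec x' y' = x \<bullet> x' + y \<bullet> y'"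
  by (simp only: inner_vec_def sum_UNIV_Plus) (simp add: block_vec_def)

lemma block_mat_mult_vec:
  fixes x y :: "real^'p::finite"
  shows "block_mat A B C D *v block_vec x y = block_vec (A *v x + B *v y) (C *v x + D *v y)"
proof -
  have "(block_mat A B C D *v block_vec x y) $ i = block_vec (A *v x + B *v y) (C *v x + D *v y) $ i" for i
    by (cases i) (simp_all only: matrix_vector_mult_def vec_lambda_beta sum_UNIV_Plus,
      simp_all add: block_mat_def block_vec_def)
  then show ?thesis by (simp add: vec_eq_iff)
qed

lemma mat_mult_vec:
  fixes x :: "real^'p::finite"
  shows "mat c *v x = c *\<^sub>R x"
proof -
  have "(mat c *v x) $ i = c * x $ i" for i
  proof -
    have "(mat c *v x) $ i = (\<Sum>j\<in>UNIV. if i = j then c * x $ j else 0)"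
      unfolding matrix_vector_mult_def mat_def vec_lambda_beta by (rule sum.cong) auto
    then show ?thesis by simp
  qed
  then show ?thesis by (simp add: vec_eq_iff)
qed

lemma sector_form:
  fixes x g :: "real^'p::finite"
  shows "block_vec x g \<bullet> (sector_mat m L *v block_vec x g) =
         - 2 * m * L * (x \<bullet> x) + 2 * (L + m) * (x \<bullet> g) - 2 * (g \<bullet> g)"
  unfolding sector_mat_def block_mat_mult_vec inner_block_vec mat_mult_vec
  by (simp add: inner_commute[of g x] algebra_simps)

definition neg_semidef :: "real^'n^'n::finite \<Rightarrow> bool"
  where "neg_semidef P \<longleftrightarrow> transpose P = P \<and> (\<forall>y. y \<bullet> (P *v y) \<le> 0)"

lemma vector_4 [simp]:
  "(vector [a, b, c, d] :: 'a::zero^4) $ 1 = a"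
  "(vector [a, b, c, d] :: 'a::zero^4) $ 2 = b"
  "(vector [a, b, c, d] :: 'a::zero^4) $ 3 = c"
  "(vector [a, b, c, d] :: 'a::zero^4) $ 4 = d"
  unfolding vector_def by simp_all

definition lmi_mat ::
  "real \<Rightarrow> real \<Rightarrow> real \<Rightarrow> real \<Rightarrow> real \<Rightarrow> real \<Rightarrow> real \<Rightarrow> real \<Rightarrow> real^4^4"
  where "lmi_mat m L \<delta> \<alpha> \<rho> l1 l2 l3 = vector [
     vector [1 - \<rho>\<^sup>2 - 2 * l1 * L * m, - \<alpha> + l1 * (L + m), 1, - \<alpha>],
     vector [- \<alpha> + l1 * (L + m), \<alpha>\<^sup>2 - 2 * l1 + \<delta>\<^sup>2 * l3, - \<alpha>, \<alpha>\<^sup>2],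
     vector [1, - \<alpha>, 1 - l2, - \<alpha>],
     vector [- \<alpha>, \<alpha>\<^sup>2, - \<alpha>, \<alpha>\<^sup>2 - l3]]"

definition T_set :: "real \<Rightarrow> real \<Rightarrow> real \<Rightarrow> real \<Rightarrow> (real \<times> real \<times> real \<times> real) set"
  where "T_set m L \<delta> \<alpha> = {(\<rho>, l1, l2, l3).
     0 \<le> \<rho> \<and> 0 \<le> l1 \<and> 0 \<le> l2 \<and> 0 \<le> l3 \<and> neg_semidef (lmi_mat m L \<delta> \<alpha> \<rho> l1 l2 l3)}"

definition alpha_minus :: "real \<Rightarrow> real \<Rightarrow> real \<Rightarrow> real"
  where "alpha_minus m L \<delta> = 1 / (1 - \<delta>) * (2 / (L + m) - \<delta> / m)"

definition alpha_plus :: "real \<Rightarrow> real \<Rightarrow> real \<Rightarrow> real"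
  where "alpha_plus m L \<delta> = 1 / (1 + \<delta>) * (2 / (L + m) + \<delta> / L)"

text \<open>Intended for \<open>0 \<le> \<alpha> \<le> 2 / ((1 + \<delta>) * L)\<close>; the first and last branch rely on these bounds.\<close>
definition rho_hat :: "real \<Rightarrow> real \<Rightarrow> real \<Rightarrow> real \<Rightarrow> real"
  where "rho_hat m L \<delta> \<alpha> =
    (if \<alpha> \<le> alpha_minus m L \<delta> then 1 - \<alpha> * m * (1 - \<delta>)
     else if \<alpha> < alpha_plus m L \<delta> then
       sqrt (1 - 2 * \<alpha> * L * m / (L + m)
             + \<alpha> * \<delta>\<^sup>2 * (L + m - 2 * \<alpha> * L * m) / (2 - \<alpha> * (L + m)))
     else (1 + \<delta>) * \<alpha> * L - 1)"

end

theory Submission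
  imports Defs
begin

text \<open>The LMI says that \<open>(x - \<alpha> g - \<alpha> w + d)\<^sup>2\<close> is at most \<open>\<rho>\<^sup>2 x\<^sup>2 + l2 d\<^sup>2\<close> plus
  nonnegative multiples of the sector and the noise forms. Write \<open>r\<close> for the claimed factor.
  Evaluating the LMI at a worst-case gradient \<open>g\<close> in the plane, noise \<open>w\<close> of norm \<open>\<delta> \<bar>g\<bar>\<close> pointing
  against \<open>1 - \<alpha> g\<close>, and an aligned drift \<open>d\<close> gives \<open>(r \<surd>U + \<sigma>)\<^sup>2 \<le> \<rho>\<^sup>2 U + l2 \<sigma>\<^sup>2\<close>.
  Conversely, explicit multipliers certify the drift-free contraction with factor \<open>r\<close> (or any
  larger one if \<open>m = L\<close>), and Young's inequality with weights \<open>r \<surd>U : \<sigma>\<close> adds the drift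
  at optimal cost.\<close>

section \<open>The matrix inequality as a scalar inequality\<close>

text \<open>The entries free of multipliers and of \<open>\<rho>\<close> form the rank-one matrix of
  the vector (1, -\<alpha>, 1, -\<alpha>), which yields the square on the left. The coordinates
  stand for error, gradient, drift and noise.\<close>

lemma neg_semidef_lmi_mat_iff:
  "neg_semidef (lmi_mat m L \<delta> \<alpha> \<rho> l1 l2 l3) \<longleftrightarrow>
    (\<forall>x g d w. (x - \<alpha> * g + d - \<alpha> * w)\<^sup>2 \<le>
      \<rho>\<^sup>2 * x\<^sup>2 + 2 * l1 * ((g - m * x) * (g - L * x)) + l2 * d\<^sup>2 + l3 * (w\<^sup>2 - \<delta>\<^sup>2 * g\<^sup>2))"
  (is "neg_semidef ?M \<longleftrightarrow> ?R")
proof -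
  have sym: "transpose ?M = ?M"
    by (simp add: vec_eq_iff forall_4 transpose_def lmi_mat_def)
  have form: "y \<bullet> (?M *v y) =
      (y$1 - \<alpha> * y$2 + y$3 - \<alpha> * y$4)\<^sup>2 - (\<rho>\<^sup>2 * (y$1)\<^sup>2 + 2 * l1 * ((y$2 - m * y$1) * (y$2 - L * y$1))
        + l2 * (y$3)\<^sup>2 + l3 * ((y$4)\<^sup>2 - \<delta>\<^sup>2 * (y$2)\<^sup>2))" for y :: "real^4"
    by (simp add: inner_vec_def matrix_vector_mult_def sum_4 lmi_mat_def power2_eq_square algebra_simps)
  show ?thesis
  proof
    assume "neg_semidef ?M"
    then have *: "y \<bullet> (?M *v y) \<le> 0" for y :: "real^4"
      by (simp add: neg_semidef_def)
    show ?R
    proof (intro allI)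
      fix x g d w :: real
      show "(x - \<alpha> * g + d - \<alpha> * w)\<^sup>2 \<le>
        \<rho>\<^sup>2 * x\<^sup>2 + 2 * l1 * ((g - m * x) * (g - L * x)) + l2 * d\<^sup>2 + l3 * (w\<^sup>2 - \<delta>\<^sup>2 * g\<^sup>2)"
        using *[of "vector [x, g, d, w]"] unfolding form by simp
    qed
  next
    assume ?R
    then show "neg_semidef ?M"
      by (simp add: neg_semidef_def sym form)
  qed
qed

section \<open>Explicit certificates and the planar lower bound\<close>

text \<open>The gap is a perfect square that vanishes when \<open>u\<close> : \<open>w\<close> =
  \<open>p\<close> : \<open>q\<close>, so the weights should mirror the sizes of the two
  summands.\<close>

lemma young_sq:
  fixes u w p q :: real
  assumes "0 < p" "0 < q"
  shows "(u + w)\<^sup>2 \<le> (p + q) / p * u\<^sup>2 + (p + q) / q * w\<^sup>2"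
proof -
  have "(p + q) / p * u\<^sup>2 + (p + q) / q * w\<^sup>2 - (u + w)\<^sup>2 = (q * u - p * w)\<^sup>2 / (p * q)"
    using assms by (simp add: field_simps power2_eq_square)
  moreover have "0 \<le> (q * u - p * w)\<^sup>2 / (p * q)"
    using assms by simp
  ultimately show ?thesis by linarith
qed

text \<open>This is the scalar form of the LMI at \<open>d = 0\<close>, where \<open>l2\<close>
  drops out. The drift is put back by \<open>T_set_of_contraction_cert\<close>.\<close>

definition contraction_cert :: "real \<Rightarrow> real \<Rightarrow> real \<Rightarrow> real \<Rightarrow> real \<Rightarrow> real \<Rightarrow> real \<Rightarrow> bool"
  where "contraction_cert m L \<delta> \<alpha> \<rho> l1 l3 \<longleftrightarrow> 0 \<le> l1 \<and> 0 \<le> l3 \<and>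
    (\<forall>x g w. (x - \<alpha> * g - \<alpha> * w)\<^sup>2 \<le>
      \<rho>\<^sup>2 * x\<^sup>2 + 2 * l1 * ((g - m * x) * (g - L * x)) + l3 * (w\<^sup>2 - \<delta>\<^sup>2 * g\<^sup>2))"

lemma contraction_cert_mono:
  assumes "contraction_cert m L \<delta> \<alpha> \<rho> l1 l3" "0 \<le> \<rho>" "\<rho> \<le> \<rho>'"
  shows "contraction_cert m L \<delta> \<alpha> \<rho>' l1 l3"
proof -
  have "\<rho>\<^sup>2 * x\<^sup>2 \<le> \<rho>'\<^sup>2 * x\<^sup>2" for x :: real
    using assms by (intro mult_right_mono power_mono) auto
  then show ?thesis
    using assms(1) unfolding contraction_cert_def by (smt (verit))
qed

text \<open>Young's inequality separates the drift \<open>d\<close> from the rest. Its first weight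
  scales the whole certificate, hence the square root on \<open>\<rho>\<close>, and its second
  weight becomes \<open>l2\<close>.\<close>

lemma T_set_of_contraction_cert:
  assumes cert: "contraction_cert m L \<delta> \<alpha> \<rho> l1 l3" and "0 \<le> \<rho>" "0 < p" "0 < q"
  shows "(sqrt ((p + q) / p) * \<rho>, (p + q) / p * l1, (p + q) / q, (p + q) / p * l3) \<in> T_set m L \<delta> \<alpha>"
proof -
  let ?A = "(p + q) / p" and ?B = "(p + q) / q"
  have A: "0 \<le> ?A" using assms by simp
  have "(x - \<alpha> * g + d - \<alpha> * w)\<^sup>2 \<le> (sqrt ?A * \<rho>)\<^sup>2 * x\<^sup>2
      + 2 * (?A * l1) * ((g - m * x) * (g - L * x)) + ?B * d\<^sup>2 + ?A * l3 * (w\<^sup>2 - \<delta>\<^sup>2 * g\<^sup>2)"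
    for x g d w
  proof -
    have "(x - \<alpha> * g + d - \<alpha> * w)\<^sup>2 = ((x - \<alpha> * g - \<alpha> * w) + d)\<^sup>2"
      by (simp add: algebra_simps)
    also have "\<dots> \<le> ?A * (x - \<alpha> * g - \<alpha> * w)\<^sup>2 + ?B * d\<^sup>2"
      using assms by (intro young_sq)
    also have "\<dots> \<le> ?A * (\<rho>\<^sup>2 * x\<^sup>2 + 2 * l1 * ((g - m * x) * (g - L * x)) + l3 * (w\<^sup>2 - \<delta>\<^sup>2 * g\<^sup>2)) + ?B * d\<^sup>2"
      using cert A unfolding contraction_cert_def by (intro add_right_mono mult_left_mono) auto
    also have "\<dots> = (sqrt ?A * \<rho>)\<^sup>2 * x\<^sup>2
      + 2 * (?A * l1) * ((g - m * x) * (g - L * x)) + ?B * d\<^sup>2 + ?A * l3 * (w\<^sup>2 - \<delta>\<^sup>2 * g\<^sup>2)"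
      unfolding power_mult_distrib real_sqrt_pow2[OF A] by (simp only: algebra_simps)
    finally show ?thesis .
  qed
  then show ?thesis
    using assms unfolding T_set_def contraction_cert_def by (auto simp: neg_semidef_lmi_mat_iff)
qed

text \<open>Eliminates the noise variable \<open>w\<close>; the weights \<open>p\<close>, \<open>q\<close> should be
  proportional to \<open>\<bar>x - \<alpha> g\<bar>\<close> and \<open>\<alpha> \<bar>w\<bar>\<close> in the worst case.\<close>
lemma contraction_certI:
  assumes "0 < p" "0 < q" "0 \<le> l1"
    and "\<And>x g. (p + q) / p * (x - \<alpha> * g)\<^sup>2 + (p + q) / q * \<alpha>\<^sup>2 * \<delta>\<^sup>2 * g\<^sup>2
      \<le> \<rho>\<^sup>2 * x\<^sup>2 + 2 * l1 * ((g - m * x) * (g - L * x))"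
  shows "contraction_cert m L \<delta> \<alpha> \<rho> l1 ((p + q) / q * \<alpha>\<^sup>2)"
  unfolding contraction_cert_def
proof (intro conjI allI)
  fix x g w :: real
  have "(x - \<alpha> * g - \<alpha> * w)\<^sup>2 \<le> (p + q) / p * (x - \<alpha> * g)\<^sup>2 + (p + q) / q * (- \<alpha> * w)\<^sup>2"
    using young_sq[OF assms(1,2), of "x - \<alpha> * g" "- \<alpha> * w"] by simp
  also have "\<dots> \<le> \<rho>\<^sup>2 * x\<^sup>2 + 2 * l1 * ((g - m * x) * (g - L * x)) + (p + q) / q * \<alpha>\<^sup>2 * (w\<^sup>2 - \<delta>\<^sup>2 * g\<^sup>2)"
    using assms(4)[of x g] by (simp add: power_mult_distrib right_diff_distrib)
  finally show "(x - \<alpha> * g - \<alpha> * w)\<^sup>2 \<le> \<rho>\<^sup>2 * x\<^sup>2 + 2 * l1 * ((g - m * x) * (g - L * x))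
      + (p + q) / q * \<alpha>\<^sup>2 * (w\<^sup>2 - \<delta>\<^sup>2 * g\<^sup>2)" .
qed (use assms in auto)

text \<open>For \<open>m = L\<close> the optimal multiplier \<open>l1\<close> is infinite, so that a certificate
  exists only with slack in \<open>\<rho>\<close>.\<close>
lemma ex_contraction_cert_eq:
  assumes "0 < m" "0 < \<delta>" "0 \<le> \<alpha>" and gt: "\<bar>1 - \<alpha> * m\<bar> + \<alpha> * \<delta> * m < \<rho>"
  shows "\<exists>l1 l3. contraction_cert m m \<delta> \<alpha> \<rho> l1 l3"
proof -
  define u v where "u = \<bar>1 - \<alpha> * m\<bar>" and "v = \<alpha> * \<delta> * m"
  have uv: "0 \<le> u" "0 \<le> v" "u + v < \<rho>"
    using assms by (auto simp: u_def v_def)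
  define e where "e = (\<rho> - u - v) / 4"
  define p q where "p = u + e" and "q = v + e"
  have e: "0 < e" using uv by (simp add: e_def)
  have pq: "0 < p" "0 < q" "p + q < \<rho>"
    using uv e by (auto simp: p_def q_def e_def field_simps)
  define A B where "A = (p + q) / p" and "B = (p + q) / q * \<alpha>\<^sup>2 * \<delta>\<^sup>2"
  have "A * (1 - \<alpha> * m)\<^sup>2 + B * m\<^sup>2 = (p + q) / p * u\<^sup>2 + (p + q) / q * v\<^sup>2"
    by (simp add: A_def B_def u_def v_def power_mult_distrib)
  also have "\<dots> \<le> (p + q) / p * p\<^sup>2 + (p + q) / q * q\<^sup>2"
    using pq uv e by (intro add_mono mult_left_mono power_mono) (auto simp: p_def q_def)
  also have "\<dots> = (p + q)\<^sup>2"
    using pq by (simp add: field_simps power2_eq_square)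
  also have "\<dots> < \<rho>\<^sup>2"
    using pq by (intro power_strict_mono) auto
  finally have less: "A * (1 - \<alpha> * m)\<^sup>2 + B * m\<^sup>2 < \<rho>\<^sup>2" .
  \<comment> \<open>For equal endpoints the sector form is \<open>h\<^sup>2\<close> with
    \<open>h = g - m * x\<close>. The form to be bounded below is then P x^2 + 2 c x h + k h^2, and
    \<open>l1\<close> is chosen so that k = c^2 / P completes the square.\<close>
  define P where "P = \<rho>\<^sup>2 - (A * (1 - \<alpha> * m)\<^sup>2 + B * m\<^sup>2)"
  define c where "c = A * \<alpha> * (1 - \<alpha> * m) - B * m"
  define l1 where "l1 = (c\<^sup>2 / P + A * \<alpha>\<^sup>2 + B) / 2"
  have P: "0 < P" using less by (simp add: P_def)
  have AB: "0 \<le> A" "0 \<le> B" using pq by (auto simp: A_def B_def)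
  have "contraction_cert m m \<delta> \<alpha> \<rho> l1 ((p + q) / q * \<alpha>\<^sup>2)"
  proof (rule contraction_certI[OF pq(1,2)])
    show "0 \<le> l1" using P AB by (simp add: l1_def)
    fix x g :: real
    define h where "h = g - m * x"
    have g: "g = m * x + h" by (simp add: h_def)
    define k where "k = c\<^sup>2 / P"
    have sq: "\<rho>\<^sup>2 = P + A * (1 - \<alpha> * m)\<^sup>2 + B * m\<^sup>2" and l1: "2 * l1 = k + A * \<alpha>\<^sup>2 + B"
      by (simp_all add: P_def l1_def k_def)
    have "\<rho>\<^sup>2 * x\<^sup>2 + 2 * l1 * ((g - m * x) * (g - m * x)) - (A * (x - \<alpha> * g)\<^sup>2 + B * g\<^sup>2)
      = P * x\<^sup>2 + 2 * c * x * h + k * h\<^sup>2"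
      unfolding sq l1 g by (simp add: c_def power2_eq_square algebra_simps)
    also have "\<dots> = (P * x + c * h)\<^sup>2 / P"
      using P by (simp add: k_def field_simps power2_eq_square)
    finally show "(p + q) / p * (x - \<alpha> * g)\<^sup>2 + (p + q) / q * \<alpha>\<^sup>2 * \<delta>\<^sup>2 * g\<^sup>2
        \<le> \<rho>\<^sup>2 * x\<^sup>2 + 2 * l1 * ((g - m * x) * (g - m * x))"
      using P unfolding A_def[symmetric] B_def[symmetric] by (smt (verit) divide_nonneg_pos zero_le_power2)
  qed
  then show ?thesis by blast
qed


text \<open>The gradient at an endpoint \<open>e\<close> of the sector, with \<open>f\<close> the other endpoint, is the worst
  case; \<open>s\<close> is the sign of the resulting factor \<open>1 - \<alpha> e\<close>.\<close>
lemma contraction_cert_endpoint: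
  assumes s: "s = 1 \<or> s = - 1" and "0 < e" "0 < \<delta>" "\<delta> < 1" "0 < \<alpha>"
    and p: "0 < s * (1 - \<alpha> * e)" and ef: "0 < s * (f - e)"
    and le: "\<alpha> * e * (f + e) * (s - \<delta>) \<le> 2 * s * e - \<delta> * (f + e)"
  shows "\<exists>l1 l3. contraction_cert e f \<delta> \<alpha> (s * (1 - \<alpha> * e) + \<alpha> * \<delta> * e) l1 l3"
proof -
  define p q where "p = s * (1 - \<alpha> * e)" and "q = \<alpha> * \<delta> * e"
  define r where "r = p + q"
  define D where "D = s * (f - e)"
  \<comment> \<open>In the variables \<open>x\<close> and \<open>h = g - e * x\<close> the terms in
    x^2 cancel because \<open>r = p + q\<close>; this \<open>l1\<close> also cancels the mixed term
    x h.\<close>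
  define l1 where "l1 = \<alpha> * r * (1 - s * \<delta>) / D"
  have ss: "s * s = 1" using s by auto
  have "0 < p" "0 < q" "0 < D"
    using assms by (simp_all add: p_def q_def D_def)
  then have pos: "0 < p" "0 < q" "0 < r" "0 < D"
    by (simp_all add: r_def)
  \<comment> \<open>This is \<open>le\<close> in terms of \<open>p\<close> and \<open>D\<close>.
    Divided by \<open>D * e * p\<close> it says that the one remaining coefficient, that of h^2, is
    nonnegative.\<close>
  have "\<alpha> * D * e + \<delta> * D * p \<le> 2 * (1 - s * \<delta>) * e * p"
  proof -
    have "2 * (1 - s * \<delta>) * e * p - (\<alpha> * D * e + \<delta> * D * p)
      = 2 * s * e - \<delta> * (f + e) - \<alpha> * e * (f + e) * (s - \<delta>)"
      using s by (auto simp: p_def D_def algebra_simps)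
    then show ?thesis using le by simp
  qed
  then have "\<alpha> / p + \<delta> / e \<le> 2 * (1 - s * \<delta>) / D"
    using pos \<open>0 < e\<close> by (simp add: field_simps)
  then have "\<alpha> * r * (\<alpha> / p + \<delta> / e) \<le> \<alpha> * r * (2 * (1 - s * \<delta>) / D)"
    using pos \<open>0 < \<alpha>\<close> by (intro mult_left_mono) auto
  then have coeff: "0 \<le> 2 * l1 - \<alpha>\<^sup>2 * r / p - \<alpha> * \<delta> * r / e"
    by (simp add: l1_def power2_eq_square algebra_simps)
  have "contraction_cert e f \<delta> \<alpha> (p + q) l1 ((p + q) / q * \<alpha>\<^sup>2)"
  proof (rule contraction_certI[OF pos(1,2)])
    show "0 \<le> l1"
      using pos s assms by (auto simp: l1_def)
    fix x g :: real
    define h where "h = g - e * x"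
    have g: "g = e * x + h" by (simp add: h_def)
    have u: "(x - \<alpha> * g)\<^sup>2 = (p * x - s * \<alpha> * h)\<^sup>2"
      using s by (auto simp: p_def g power2_eq_square algebra_simps)
    have 1: "r / p * (p * x - s * \<alpha> * h)\<^sup>2 = r * p * x\<^sup>2 - 2 * r * s * \<alpha> * x * h + \<alpha>\<^sup>2 * r / p * h\<^sup>2"
      using pos s by (auto simp: field_simps power2_eq_square)
    have 2: "r / q * \<alpha>\<^sup>2 * \<delta>\<^sup>2 * g\<^sup>2 = r * q * x\<^sup>2 + 2 * r * \<alpha> * \<delta> * x * h + \<alpha> * \<delta> * r / e * h\<^sup>2"
      using pos assms by (simp add: q_def g field_simps power2_eq_square)
    have "2 * l1 * D = 2 * \<alpha> * r * (1 - s * \<delta>)"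
      using pos by (simp add: l1_def)
    then have "2 * l1 * (f - e) = 2 * \<alpha> * r * (s - \<delta>)"
      using s by (auto simp: D_def algebra_simps)
    then have 3: "2 * l1 * ((g - e * x) * (g - f * x)) = 2 * l1 * h\<^sup>2 - 2 * \<alpha> * r * (s - \<delta>) * x * h"
      unfolding g by (simp add: power2_eq_square) algebra
    have "r\<^sup>2 * x\<^sup>2 + 2 * l1 * ((g - e * x) * (g - f * x)) - (r / p * (x - \<alpha> * g)\<^sup>2 + r / q * \<alpha>\<^sup>2 * \<delta>\<^sup>2 * g\<^sup>2)
      = (2 * l1 - \<alpha>\<^sup>2 * r / p - \<alpha> * \<delta> * r / e) * h\<^sup>2"
      unfolding u 1 2 3 by (simp add: r_def power2_eq_square algebra_simps)
    also have "0 \<le> \<dots>" using coeff by (intro mult_nonneg_nonneg) auto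
    finally show "(p + q) / p * (x - \<alpha> * g)\<^sup>2 + (p + q) / q * \<alpha>\<^sup>2 * \<delta>\<^sup>2 * g\<^sup>2
      \<le> (p + q)\<^sup>2 * x\<^sup>2 + 2 * l1 * ((g - e * x) * (g - f * x))"
      by (simp add: r_def)
  qed
  then show ?thesis unfolding p_def q_def by blast
qed

lemma contraction_cert_commute:
  "contraction_cert m L \<delta> \<alpha> \<rho> l1 l3 = contraction_cert L m \<delta> \<alpha> \<rho> l1 l3"
  unfolding contraction_cert_def by (simp add: mult.commute)

text \<open>The weights are in the ratio of |1 - \<alpha> g| to \<alpha> \<delta> |g| at the
  gradient built in \<open>ex_worst_gradient\<close>, where they are called \<open>b\<close> and
  \<open>q\<close>. With them, the inequality required by \<open>contraction_certI\<close> becomes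
  an identity in \<open>x\<close> and \<open>g\<close>.\<close>

lemma contraction_cert_interior:
  assumes "0 < L + m" "0 < \<delta>" "0 < \<alpha>" "\<alpha> * (L + m) < 2"
    and sq: "\<rho>\<^sup>2 = 1 - 2 * \<alpha> * L * m / (L + m) + \<alpha> * \<delta>\<^sup>2 * (L + m - 2 * \<alpha> * L * m) / (2 - \<alpha> * (L + m))"
  shows "\<exists>l1 l3. contraction_cert m L \<delta> \<alpha> \<rho> l1 l3"
proof -
  define S where "S = L + m"
  define p q where "p = 2 - \<alpha> * S" and "q = \<alpha> * \<delta>\<^sup>2 * S"
  define l1 where "l1 = (p + q) / p * (\<alpha> / S)"
  have pos: "0 < p" "0 < q" "0 < S"
    using assms by (auto simp: p_def q_def S_def)
  have sq': "\<rho>\<^sup>2 = (p + q) / p * ((S - 2 * \<alpha> * L * m) / S)"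
  proof -
    have "\<rho>\<^sup>2 = 1 - 2 * \<alpha> * L * m / S + \<alpha> * \<delta>\<^sup>2 * (S - 2 * \<alpha> * L * m) / p"
      unfolding sq p_def S_def ..
    also have "\<dots> = (p + q) / p * ((S - 2 * \<alpha> * L * m) / S)"
      using pos by (simp add: q_def field_simps)
    finally show ?thesis .
  qed
  have "contraction_cert m L \<delta> \<alpha> \<rho> l1 ((p + q) / q * \<alpha>\<^sup>2)"
  proof (rule contraction_certI[OF pos(1,2)])
    show "0 \<le> l1"
      using pos assms by (simp add: l1_def)
    fix x g :: real
    have 1: "(p + q) / q * \<alpha>\<^sup>2 * \<delta>\<^sup>2 * g\<^sup>2 = (p + q) / p * (\<alpha> * p / S * g\<^sup>2)"
      using pos assms by (simp add: q_def field_simps power2_eq_square)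
    have 2: "(x - \<alpha> * g)\<^sup>2 + \<alpha> * p / S * g\<^sup>2
      = (S - 2 * \<alpha> * L * m) / S * x\<^sup>2 + 2 * (\<alpha> / S) * ((g - m * x) * (g - L * x))"
    proof -
      have "S * ((x - \<alpha> * g)\<^sup>2 + \<alpha> * p / S * g\<^sup>2)
        = S * ((S - 2 * \<alpha> * L * m) / S * x\<^sup>2 + 2 * (\<alpha> / S) * ((g - m * x) * (g - L * x)))"
        using pos by (simp add: distrib_left) (simp add: p_def S_def power2_eq_square algebra_simps)
      then show ?thesis using pos by simp
    qed
    have "(p + q) / p * (x - \<alpha> * g)\<^sup>2 + (p + q) / q * \<alpha>\<^sup>2 * \<delta>\<^sup>2 * g\<^sup>2
      = (p + q) / p * ((x - \<alpha> * g)\<^sup>2 + \<alpha> * p / S * g\<^sup>2)"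
      unfolding 1 by (simp only: distrib_left)
    also have "\<dots> = \<rho>\<^sup>2 * x\<^sup>2 + 2 * l1 * ((g - m * x) * (g - L * x))"
      unfolding 2 sq' l1_def by (simp only: distrib_left mult.assoc mult.left_commute)
    finally show "(p + q) / p * (x - \<alpha> * g)\<^sup>2 + (p + q) / q * \<alpha>\<^sup>2 * \<delta>\<^sup>2 * g\<^sup>2
      \<le> \<rho>\<^sup>2 * x\<^sup>2 + 2 * l1 * ((g - m * x) * (g - L * x))" by simp
  qed
  then show ?thesis by blast
qed

text \<open>The quadratic form of the LMI is scalar, so it may be summed over the two coordinates of
  the plane. Planar data are needed because in the middle regime of \<open>\<alpha>\<close> the worst gradient is not
  parallel to the error.\<close>
lemma T_set_lower_bound:
  fixes g :: complex
  assumes T: "(\<rho>, l1, l2, l3) \<in> T_set m L \<delta> \<alpha>" and "0 \<le> \<delta>" "0 \<le> \<alpha>" "0 \<le> a" "0 \<le> b"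
    and sector: "(Re g - m) * (Re g - L) + (Im g)\<^sup>2 \<le> 0"
  shows "((cmod (1 - \<alpha> * g) + \<alpha> * \<delta> * cmod g) * a + b)\<^sup>2 \<le> \<rho>\<^sup>2 * a\<^sup>2 + l2 * b\<^sup>2"
proof -
  define u where "u = 1 - \<alpha> * g"
  \<comment> \<open>The fallback value 1 keeps \<open>n\<close> a unit vector when \<open>u\<close>
    vanishes, so that the drift still has norm \<open>b\<close>.\<close>
  define n where "n = (if u = 0 then 1 else sgn u)"
  have n: "cmod n = 1" "u = of_real (cmod u) * n"
    by (auto simp: n_def norm_sgn) (simp add: sgn_eq)
  \<comment> \<open>All contributions to the next error are nonnegative multiples of
    \<open>n\<close>, so their norms add up. The norm of \<open>w\<close> is the largest allowed
    one, which makes the noise form vanish.\<close>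
  define w d where "w = - of_real (\<delta> * cmod g * a) * n" and "d = of_real b * n"
  define k where "k = a * g"
  have l: "0 \<le> l1" "0 \<le> l3"
    and form: "(x - \<alpha> * y + d - \<alpha> * w)\<^sup>2 \<le> \<rho>\<^sup>2 * x\<^sup>2 + 2 * l1 * ((y - m * x) * (y - L * x))
      + l2 * d\<^sup>2 + l3 * (w\<^sup>2 - \<delta>\<^sup>2 * y\<^sup>2)" for x y d w :: real
    using T by (auto simp: T_set_def neg_semidef_lmi_mat_iff)
  have "of_real a - \<alpha> * k + d - \<alpha> * w = of_real ((cmod u + \<alpha> * \<delta> * cmod g) * a + b) * n"
  proof -
    have "of_real a - \<alpha> * k = of_real a * u"
      by (simp add: u_def k_def algebra_simps)
    also have "\<dots> = of_real a * (of_real (cmod u) * n)"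
      using n(2) by simp
    finally show ?thesis
      by (simp add: w_def d_def algebra_simps)
  qed
  then have "((cmod u + \<alpha> * \<delta> * cmod g) * a + b)\<^sup>2 = (cmod (of_real a - \<alpha> * k + d - \<alpha> * w))\<^sup>2"
    by (simp add: norm_mult n(1) del: of_real_add of_real_mult)
  also have "\<dots> = (a - \<alpha> * Re k + Re d - \<alpha> * Re w)\<^sup>2 + (0 - \<alpha> * Im k + Im d - \<alpha> * Im w)\<^sup>2"
    unfolding cmod_power2 by simp
  also have "\<dots> \<le> \<rho>\<^sup>2 * a\<^sup>2 + 2 * l1 * ((Re k - m * a) * (Re k - L * a) + (Im k)\<^sup>2)
      + l2 * ((Re d)\<^sup>2 + (Im d)\<^sup>2) + l3 * ((Re w)\<^sup>2 + (Im w)\<^sup>2 - \<delta>\<^sup>2 * ((Re k)\<^sup>2 + (Im k)\<^sup>2))"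
    using add_mono[OF form[of a "Re k" "Re d" "Re w"] form[of 0 "Im k" "Im d" "Im w"]]
    by (simp add: algebra_simps power2_eq_square)
  also have "\<dots> = \<rho>\<^sup>2 * a\<^sup>2 + 2 * l1 * (a\<^sup>2 * ((Re g - m) * (Re g - L) + (Im g)\<^sup>2)) + l2 * b\<^sup>2"
  proof -
    have "(Re d)\<^sup>2 + (Im d)\<^sup>2 = b\<^sup>2"
      unfolding cmod_power2[symmetric] using assms by (simp add: d_def norm_mult n(1))
    moreover have "(Re w)\<^sup>2 + (Im w)\<^sup>2 = \<delta>\<^sup>2 * ((Re k)\<^sup>2 + (Im k)\<^sup>2)"
      unfolding cmod_power2[symmetric] using assms
      by (simp add: w_def k_def norm_mult n(1) power_mult_distrib del: of_real_mult)
    ultimately show ?thesis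
      by (simp add: k_def algebra_simps power2_eq_square)
  qed
  also have "\<dots> \<le> \<rho>\<^sup>2 * a\<^sup>2 + l2 * b\<^sup>2"
    using l(1) sector by (simp add: mult_nonneg_nonpos)
  finally show ?thesis by (simp add: u_def)
qed

section \<open>Step-size thresholds and the three regimes\<close>

locale step_parameters =
  fixes m L \<delta> \<alpha> :: real
  assumes m_pos: "0 < m" and m_le_L: "m \<le> L" and \<delta>_pos: "0 < \<delta>"
    and \<delta>_less: "\<delta> < 2 * m / (L + m)" and \<alpha>_nonneg: "0 \<le> \<alpha>"
begin

lemma L_pos: "0 < L" and sum_pos: "0 < L + m"
  using m_pos m_le_L by auto

lemma \<delta>_sum_less: "\<delta> * (L + m) < 2 * m"
  using \<delta>_less sum_pos by (simp add: field_simps)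

lemma \<delta>_less_1: "\<delta> < 1"
proof -
  have "2 * m / (L + m) \<le> 1"
    using m_le_L sum_pos by simp
  then show ?thesis using \<delta>_less by linarith
qed

text \<open>Clearing denominators gives the assumption \<open>le\<close> of
  \<open>contraction_cert_endpoint\<close> for \<open>e = m\<close>, \<open>s = 1\<close>. Likewise
  the negation of \<open>less_alpha_plus_iff\<close> gives it for \<open>e = L\<close>,
  \<open>s = - 1\<close>.\<close>

lemma le_alpha_minus_iff:
  "\<alpha> \<le> alpha_minus m L \<delta> \<longleftrightarrow> \<alpha> * m * (L + m) * (1 - \<delta>) \<le> 2 * m - \<delta> * (L + m)"
proof -
  have "alpha_minus m L \<delta> = (2 * m - \<delta> * (L + m)) / (m * (L + m) * (1 - \<delta>))"
    using m_pos sum_pos \<delta>_less_1 by (simp add: alpha_minus_def divide_simps)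
  moreover have "0 < m * (L + m) * (1 - \<delta>)"
    using m_pos sum_pos \<delta>_less_1 by simp
  ultimately show ?thesis by (simp add: pos_le_divide_eq mult.assoc)
qed

lemma less_alpha_plus_iff:
  "\<alpha> < alpha_plus m L \<delta> \<longleftrightarrow> \<alpha> * L * (L + m) * (1 + \<delta>) < 2 * L + \<delta> * (L + m)"
proof -
  have "alpha_plus m L \<delta> = (2 * L + \<delta> * (L + m)) / (L * (L + m) * (1 + \<delta>))"
    using L_pos sum_pos \<delta>_pos by (simp add: alpha_plus_def divide_simps)
  moreover have "0 < L * (L + m) * (1 + \<delta>)"
    using L_pos sum_pos \<delta>_pos by simp
  ultimately show ?thesis by (simp add: pos_less_divide_eq mult.assoc)
qed

lemma alpha_minus_pos: "0 < alpha_minus m L \<delta>"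
proof -
  have "\<delta> / m < 2 / (L + m)"
    using \<delta>_less m_pos by (simp add: field_simps)
  then show ?thesis
    using \<delta>_less_1 by (simp add: alpha_minus_def)
qed

text \<open>As m \<le> L, the upper threshold is at most 2 / (L + m). This makes the denominator in
  the middle branch of \<open>rho_hat\<close> positive.\<close>

lemma interior_sum_less:
  assumes "\<alpha> < alpha_plus m L \<delta>"
  shows "\<alpha> * (L + m) < 2"
proof -
  have "\<delta> * (L + m) \<le> \<delta> * (2 * L)"
    using m_le_L \<delta>_pos by (intro mult_left_mono) auto
  then have "(\<alpha> * (L + m)) * (L * (1 + \<delta>)) < 2 * (L * (1 + \<delta>))"
    using assms unfolding less_alpha_plus_iff by (simp add: algebra_simps)
  moreover have "0 < L * (1 + \<delta>)"
    using L_pos \<delta>_pos by simp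
  ultimately show ?thesis
    by (simp only: mult_less_cancel_right_pos)
qed

text \<open>Follows from 4 L m \<le> (L + m)^2. The quantity is a common factor of the radicand in
  the middle branch of \<open>rho_hat\<close>.\<close>

lemma interior_excess_nonneg:
  assumes "\<alpha> * (L + m) < 2"
  shows "0 \<le> L + m - 2 * \<alpha> * L * m"
proof -
  have "(2 * \<alpha> * L * m) * (L + m) = (\<alpha> * (L + m)) * (2 * L * m)"
    by simp
  also have "\<dots> \<le> 2 * (2 * L * m)"
    using assms m_pos L_pos by (intro mult_right_mono) auto
  also have "\<dots> \<le> (L + m) * (L + m)"
    using zero_le_power2[of "L - m"] by (simp add: power2_eq_square algebra_simps)
  finally show ?thesis using sum_pos by simp
qed

lemma rho_hat_interior_sq:
  assumes "\<not> \<alpha> \<le> alpha_minus m L \<delta>" "\<alpha> < alpha_plus m L \<delta>"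
  shows "(rho_hat m L \<delta> \<alpha>)\<^sup>2 = 1 - 2 * \<alpha> * L * m / (L + m)
    + \<alpha> * \<delta>\<^sup>2 * (L + m - 2 * \<alpha> * L * m) / (2 - \<alpha> * (L + m))"
    and "0 \<le> rho_hat m L \<delta> \<alpha>"
proof -
  have less: "\<alpha> * (L + m) < 2" by (rule interior_sum_less[OF assms(2)])
  note K = interior_excess_nonneg[OF less]
  have "0 \<le> 1 - 2 * \<alpha> * L * m / (L + m)"
    using K sum_pos by (simp add: field_simps)
  moreover have "0 \<le> \<alpha> * \<delta>\<^sup>2 * (L + m - 2 * \<alpha> * L * m) / (2 - \<alpha> * (L + m))"
    using K less \<alpha>_nonneg by (intro divide_nonneg_nonneg mult_nonneg_nonneg) auto
  ultimately have "0 \<le> 1 - 2 * \<alpha> * L * m / (L + m)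
    + \<alpha> * \<delta>\<^sup>2 * (L + m - 2 * \<alpha> * L * m) / (2 - \<alpha> * (L + m))" by linarith
  then show "(rho_hat m L \<delta> \<alpha>)\<^sup>2 = 1 - 2 * \<alpha> * L * m / (L + m)
    + \<alpha> * \<delta>\<^sup>2 * (L + m - 2 * \<alpha> * L * m) / (2 - \<alpha> * (L + m))"
    and "0 \<le> rho_hat m L \<delta> \<alpha>"
    unfolding rho_hat_def using assms by simp_all
qed

text \<open>The threshold condition rearranges to (1 - \<alpha> m) (L + m) (1 - \<delta>) \<ge> L -
  m. The strict version supplies the positive weight \<open>p\<close> in
  \<open>contraction_cert_endpoint\<close>.\<close>

lemma short_step_contracts:
  assumes "\<alpha> \<le> alpha_minus m L \<delta>"
  shows "\<alpha> * m \<le> 1" and "m < L \<Longrightarrow> \<alpha> * m < 1"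
proof -
  have "(\<alpha> * m) * ((L + m) * (1 - \<delta>)) \<le> (L + m) * (1 - \<delta>) - (L - m)"
    using assms unfolding le_alpha_minus_iff by (simp add: algebra_simps)
  then have *: "(1 - \<alpha> * m) * ((L + m) * (1 - \<delta>)) \<ge> L - m"
    by (simp add: algebra_simps)
  have pos: "0 < (L + m) * (1 - \<delta>)"
    using sum_pos \<delta>_less_1 by simp
  have "0 \<le> (1 - \<alpha> * m) * ((L + m) * (1 - \<delta>))"
    using * m_le_L by linarith
  then show "\<alpha> * m \<le> 1" using pos by (simp add: zero_le_mult_iff)
  assume "m < L"
  then have "0 < (1 - \<alpha> * m) * ((L + m) * (1 - \<delta>))"
    using * by linarith
  then show "\<alpha> * m < 1" using pos by (simp add: zero_less_mult_iff)
qed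

lemma long_step_overshoots:
  assumes "\<not> \<alpha> < alpha_plus m L \<delta>"
  shows "1 \<le> \<alpha> * L" and "m < L \<Longrightarrow> 1 < \<alpha> * L"
proof -
  have *: "(\<alpha> * L - 1) * ((L + m) * (1 + \<delta>)) \<ge> L - m"
    using assms unfolding less_alpha_plus_iff by (simp add: algebra_simps)
  have pos: "0 < (L + m) * (1 + \<delta>)"
    using sum_pos \<delta>_pos by simp
  have "0 \<le> (\<alpha> * L - 1) * ((L + m) * (1 + \<delta>))"
    using * m_le_L by linarith
  then show "1 \<le> \<alpha> * L" using pos by (simp add: zero_le_mult_iff)
  assume "m < L"
  then have "0 < (\<alpha> * L - 1) * ((L + m) * (1 + \<delta>))"
    using * by linarith
  then show "1 < \<alpha> * L" using pos by (simp add: zero_less_mult_iff)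
qed

lemma rho_hat_nonneg: "0 \<le> rho_hat m L \<delta> \<alpha>"
proof -
  consider "\<alpha> \<le> alpha_minus m L \<delta>" | "\<not> \<alpha> \<le> alpha_minus m L \<delta>" "\<alpha> < alpha_plus m L \<delta>"
    | "\<not> \<alpha> \<le> alpha_minus m L \<delta>" "\<not> \<alpha> < alpha_plus m L \<delta>" by blast
  then show ?thesis
  proof cases
    case 1
    have "0 \<le> \<alpha> * m * \<delta>"
      using \<alpha>_nonneg m_pos \<delta>_pos by simp
    then show ?thesis
      using short_step_contracts(1)[OF 1] 1 by (simp add: rho_hat_def algebra_simps)
  next
    case 2
    then show ?thesis by (rule rho_hat_interior_sq(2))
  next
    case 3
    have "0 \<le> \<alpha> * L * \<delta>"
      using \<alpha>_nonneg L_pos \<delta>_pos by simp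
    then show ?thesis
      using long_step_overshoots(1)[OF 3(2)] 3 by (simp add: rho_hat_def algebra_simps)
  qed
qed

section \<open>Certificates and worst gradients in every regime\<close>

text \<open>The strict inequality provides the slack for \<open>m = L\<close>. For
  \<open>m < L\<close> a certificate is built at \<open>rho_hat\<close> itself and weakened by
  monotonicity.\<close>

lemma ex_contraction_cert:
  assumes "rho_hat m L \<delta> \<alpha> < \<rho>"
  shows "\<exists>l1 l3. contraction_cert m L \<delta> \<alpha> \<rho> l1 l3"
proof (cases "m = L")
  case True
  have "\<bar>1 - \<alpha> * m\<bar> + \<alpha> * \<delta> * m \<le> rho_hat m L \<delta> \<alpha>"
  proof -
    \<comment> \<open>For \<open>m = L\<close> both thresholds equal 1 / m, so the middle regime is
      empty.\<close>
    consider "\<alpha> \<le> alpha_minus m L \<delta>" | "\<not> \<alpha> \<le> alpha_minus m L \<delta>" "\<not> \<alpha> < alpha_plus m L \<delta>"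
    proof -
      have "\<alpha> \<le> alpha_minus m L \<delta>" if "\<alpha> < alpha_plus m L \<delta>"
      proof -
        have "\<alpha> * m \<le> 1"
          using interior_sum_less[OF that] True by (simp add: algebra_simps)
        then have "(\<alpha> * m) * (2 * m * (1 - \<delta>)) \<le> 1 * (2 * m * (1 - \<delta>))"
          using m_pos \<delta>_less_1 by (intro mult_right_mono) auto
        then show ?thesis
          unfolding le_alpha_minus_iff using True by (simp add: algebra_simps)
      qed
      then show thesis using that by blast
    qed
    then show ?thesis
    proof cases
      case 1
      then show ?thesis
        using short_step_contracts(1)[OF 1] by (simp add: rho_hat_def algebra_simps)
    next
      case 2
      then show ?thesis
        using long_step_overshoots(1)[OF 2(2)] True by (simp add: rho_hat_def algebra_simps)
    qed
  qed
  then show ?thesis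
    using ex_contraction_cert_eq[of m \<delta> \<alpha> \<rho>] True m_pos \<delta>_pos \<alpha>_nonneg assms by simp
next
  case False
  then have less: "m < L" using m_le_L by simp
  have "\<exists>l1 l3. contraction_cert m L \<delta> \<alpha> (rho_hat m L \<delta> \<alpha>) l1 l3"
  proof (cases "\<alpha> = 0")
    case True
    \<comment> \<open>A zero step would make the weight \<open>q\<close> vanish. Here
      \<open>rho_hat\<close> is 1, since a positive lower threshold selects the first
      branch.\<close>
    then have "contraction_cert m L \<delta> \<alpha> (rho_hat m L \<delta> \<alpha>) 0 0"
      using alpha_minus_pos by (simp add: contraction_cert_def rho_hat_def)
    then show ?thesis by blast
  next
    case False
    then have \<alpha>: "0 < \<alpha>" using \<alpha>_nonneg by simp
    consider "\<alpha> \<le> alpha_minus m L \<delta>" | "\<not> \<alpha> \<le> alpha_minus m L \<delta>" "\<alpha> < alpha_plus m L \<delta>"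
      | "\<not> \<alpha> \<le> alpha_minus m L \<delta>" "\<not> \<alpha> < alpha_plus m L \<delta>" by blast
    then show ?thesis
    proof cases
      case 1
      have "rho_hat m L \<delta> \<alpha> = 1 * (1 - \<alpha> * m) + \<alpha> * \<delta> * m"
        using 1 by (simp add: rho_hat_def algebra_simps)
      moreover have "\<exists>l1 l3. contraction_cert m L \<delta> \<alpha> (1 * (1 - \<alpha> * m) + \<alpha> * \<delta> * m) l1 l3"
        using \<alpha> less m_pos \<delta>_pos \<delta>_less_1 short_step_contracts(2)[OF 1 less] 1[unfolded le_alpha_minus_iff]
        by (intro contraction_cert_endpoint) auto
      ultimately show ?thesis by simp
    next
      case 2
      show ?thesis
        using contraction_cert_interior[OF sum_pos \<delta>_pos \<alpha> interior_sum_less[OF 2(2)] rho_hat_interior_sq(1)[OF 2]] .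
    next
      case 3
      have "rho_hat m L \<delta> \<alpha> = - 1 * (1 - \<alpha> * L) + \<alpha> * \<delta> * L"
        using 3 by (simp add: rho_hat_def algebra_simps)
      moreover have "\<exists>l1 l3. contraction_cert L m \<delta> \<alpha> (- 1 * (1 - \<alpha> * L) + \<alpha> * \<delta> * L) l1 l3"
      proof (rule contraction_cert_endpoint)
        show "\<alpha> * L * (m + L) * (- 1 - \<delta>) \<le> 2 * - 1 * L - \<delta> * (m + L)"
          using 3(2)[unfolded less_alpha_plus_iff] by (simp add: algebra_simps)
      qed (use \<alpha> less L_pos \<delta>_pos \<delta>_less_1 long_step_overshoots(2)[OF 3(2) less] in auto)
      ultimately show ?thesis by (simp add: contraction_cert_commute[of m L])
    qed
  qed
  then show ?thesis
    using contraction_cert_mono[OF _ rho_hat_nonneg less_imp_le[OF assms]] by blast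
qed

text \<open>On the boundary circle of the sector, both \<open>\<bar>g\<bar>\<^sup>2\<close> and \<open>\<bar>1 - \<alpha> g\<bar>\<^sup>2\<close> are affine in \<open>Re g\<close>.
  In the middle regime \<open>g\<close> is the point where the Cauchy-Schwarz bound on
  \<open>\<bar>1 - \<alpha> g\<bar> + \<alpha> \<delta> \<bar>g\<bar>\<close> is attained.\<close>
lemma ex_worst_gradient:
  "\<exists>g :: complex. (Re g - m) * (Re g - L) + (Im g)\<^sup>2 \<le> 0 \<and>
    rho_hat m L \<delta> \<alpha> \<le> cmod (1 - \<alpha> * g) + \<alpha> * \<delta> * cmod g"
proof -
  have real_case: "cmod (1 - \<alpha> * of_real e) = \<bar>1 - \<alpha> * e\<bar>" for e
  proof -
    have "1 - \<alpha> * of_real e = complex_of_real (1 - \<alpha> * e)" by simp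
    then show ?thesis by (simp only: norm_of_real)
  qed
  consider "\<alpha> \<le> alpha_minus m L \<delta>" | "\<not> \<alpha> \<le> alpha_minus m L \<delta>" "\<alpha> < alpha_plus m L \<delta>"
    | "\<not> \<alpha> \<le> alpha_minus m L \<delta>" "\<not> \<alpha> < alpha_plus m L \<delta>" by blast
  then show ?thesis
  proof cases
    case 1
    have "rho_hat m L \<delta> \<alpha> \<le> cmod (1 - \<alpha> * of_real m) + \<alpha> * \<delta> * cmod (of_real m)"
      unfolding real_case using 1 m_pos by (simp add: rho_hat_def algebra_simps)
    then show ?thesis by (intro exI[of _ "of_real m"]) simp
  next
    case 3
    have "rho_hat m L \<delta> \<alpha> \<le> cmod (1 - \<alpha> * of_real L) + \<alpha> * \<delta> * cmod (of_real L)"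
      unfolding real_case using 3 L_pos by (simp add: rho_hat_def algebra_simps)
    then show ?thesis by (intro exI[of _ "of_real L"]) simp
  next
    case 2
    define S where "S = L + m"
    define b where "b = 2 - \<alpha> * S"
    define q where "q = \<alpha> * \<delta>\<^sup>2 * S"
    define K where "K = S - 2 * \<alpha> * L * m"
    have b: "0 < b" using interior_sum_less[OF 2(2)] by (simp add: b_def S_def)
    have K: "0 \<le> K"
      using interior_excess_nonneg[OF interior_sum_less[OF 2(2)]] by (simp add: K_def S_def)
    have S: "0 < S" using sum_pos by (simp add: S_def)
    have q: "0 \<le> q" using S \<alpha>_nonneg by (simp add: q_def)
    \<comment> \<open>On the circle, S |1 - \<alpha> g|^2 + \<alpha> b |g|^2 = K. Equality in
      Cauchy-Schwarz requires |1 - \<alpha> g| = b c and |g| = \<delta> S c, and the constraint then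
      determines \<open>c\<close>.\<close>
    define c where "c = sqrt (K / (S * b * (b + q)))"
    have c: "0 \<le> c" "c\<^sup>2 = K / (S * b * (b + q))"
      using K S b q by (simp_all add: c_def)
    then have cK: "S * b * (b + q) * c\<^sup>2 = K"
      using S b q by simp
    define G where "G = (\<delta> * S * c)\<^sup>2"
    have G: "b * (b + q) * G = \<delta>\<^sup>2 * S * K"
      unfolding G_def cK[symmetric] by (simp add: power2_eq_square)
    \<comment> \<open>A point of the circle with squared norm \<open>G\<close> exists once m^2 \<le>
      G \<le> L^2. Writing the gap at each endpoint as a difference of squares lets the two
      thresholds decide its sign.\<close>
    have id: "b * (b + q) * (G - e\<^sup>2) = (\<delta> * S * (1 - \<alpha> * e))\<^sup>2 - (e * b)\<^sup>2" if "e = m \<or> e = L" for e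
    proof -
      have "b * (b + q) * (G - e\<^sup>2) = \<delta>\<^sup>2 * S * K - b * (b + q) * e\<^sup>2"
        by (simp add: right_diff_distrib G)
      also have "\<dots> = (\<delta> * S * (1 - \<alpha> * e))\<^sup>2 - (e * b)\<^sup>2"
        using that by (auto simp: K_def q_def b_def S_def power2_eq_square algebra_simps)
      finally show ?thesis .
    qed
    have bq: "0 < b * (b + q)" using b q by simp
    have "(m * b)\<^sup>2 \<le> (\<delta> * S * (1 - \<alpha> * m))\<^sup>2"
    proof (rule power_mono)
      show "m * b \<le> \<delta> * S * (1 - \<alpha> * m)"
        using 2(1) unfolding le_alpha_minus_iff by (simp add: b_def S_def algebra_simps)
      show "0 \<le> m * b" using m_pos b by simp
    qed
    then have "0 \<le> b * (b + q) * (G - m\<^sup>2)" by (simp add: id)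
    then have Gm: "m\<^sup>2 \<le> G" using bq by (simp add: zero_le_mult_iff)
    have "(\<delta> * S * (1 - \<alpha> * L))\<^sup>2 \<le> (L * b)\<^sup>2"
    proof -
      have "- (L * b) \<le> \<delta> * S * (1 - \<alpha> * L)"
        using 2(2) unfolding less_alpha_plus_iff by (simp add: b_def S_def algebra_simps)
      moreover have "\<delta> * S * (1 - \<alpha> * L) \<le> L * b"
      proof (cases "\<alpha> * L \<le> 1")
        case True
        then have "\<delta> * S * (1 - \<alpha> * L) \<le> 2 * m * (1 - \<alpha> * L)"
          using \<delta>_sum_less by (intro mult_right_mono) (auto simp: S_def)
        also have "\<dots> \<le> L * b"
        proof -
          have "L * b - 2 * m * (1 - \<alpha> * L) = (L - m) * (1 + (1 - \<alpha> * L))"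
            by (simp add: b_def S_def algebra_simps)
          also have "0 \<le> \<dots>" using True m_le_L by (intro mult_nonneg_nonneg) auto
          finally show ?thesis by simp
        qed
        finally show ?thesis .
      next
        case False
        then have "\<delta> * S * (1 - \<alpha> * L) \<le> 0"
          using \<delta>_pos S by (intro mult_nonneg_nonpos) auto
        moreover have "0 \<le> L * b" using L_pos b by simp
        ultimately show ?thesis by linarith
      qed
      ultimately have "\<bar>\<delta> * S * (1 - \<alpha> * L)\<bar> \<le> \<bar>L * b\<bar>" by linarith
      then show ?thesis by (simp only: abs_le_square_iff)
    qed
    then have "b * (b + q) * (G - L\<^sup>2) \<le> 0" by (simp add: id)
    then have GL: "G \<le> L\<^sup>2" using bq b q by (auto simp: mult_le_0_iff)
    \<comment> \<open>On the circle with diameter from \<open>m\<close> to \<open>L\<close>, |g|^2 =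
      S Re g - L m; this is solved for the real part.\<close>
    define a where "a = (G + L * m) / S"
    have aS: "S * a = G + L * m" using S by (simp add: a_def)
    have "S * m \<le> S * a" "S * a \<le> S * L"
      unfolding aS using Gm GL by (simp_all add: S_def power2_eq_square algebra_simps)
    then have a: "m \<le> a" "a \<le> L" using S by simp_all
    define g where "g = Complex a (sqrt ((a - m) * (L - a)))"
    have Im: "(Im g)\<^sup>2 = (a - m) * (L - a)" using a by (simp add: g_def)
    have Re: "Re g = a" by (simp add: g_def)
    have norm_g: "(cmod g)\<^sup>2 = G"
      unfolding cmod_power2 Im Re using aS by (simp add: S_def power2_eq_square algebra_simps)
    then have "cmod g = sqrt G"
      by (metis norm_ge_zero real_sqrt_unique)
    also have "\<dots> = \<delta> * S * c"
      unfolding G_def using c S \<delta>_pos by simp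
    finally have 1: "cmod g = \<delta> * S * c" .
    have "S * (cmod (1 - \<alpha> * g))\<^sup>2 = S * (1 - 2 * \<alpha> * a + \<alpha>\<^sup>2 * (cmod g)\<^sup>2)"
      unfolding cmod_power2 by (simp add: Re power2_eq_square algebra_simps)
    also have "\<dots> = S - 2 * \<alpha> * (S * a) + \<alpha>\<^sup>2 * S * G"
      unfolding norm_g by (simp add: algebra_simps)
    also have "\<dots> = K - \<alpha> * b * G"
      unfolding aS K_def b_def by (simp add: algebra_simps power2_eq_square)
    also have "\<dots> = S * (b * c)\<^sup>2"
      unfolding G_def cK[symmetric] q_def by (simp add: algebra_simps power2_eq_square)
    finally have "(cmod (1 - \<alpha> * g))\<^sup>2 = (b * c)\<^sup>2" using S by simp
    then have "cmod (1 - \<alpha> * g) = b * c"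
      using b c(1) by (simp add: power2_eq_iff_nonneg)
    then have val: "cmod (1 - \<alpha> * g) + \<alpha> * \<delta> * cmod g = (b + q) * c"
      unfolding 1 q_def by (simp add: algebra_simps power2_eq_square)
    have "(rho_hat m L \<delta> \<alpha>)\<^sup>2 = K / S + \<alpha> * \<delta>\<^sup>2 * K / b"
      unfolding rho_hat_interior_sq(1)[OF 2] using S by (simp add: K_def S_def b_def diff_divide_distrib)
    also have "\<dots> = (b + q) * (K / (S * b))"
      using S b by (simp add: q_def field_simps)
    also have "K / (S * b) = (b + q) * c\<^sup>2"
      unfolding cK[symmetric] using S b by simp
    finally have "(rho_hat m L \<delta> \<alpha>)\<^sup>2 = ((b + q) * c)\<^sup>2"
      by (simp add: power2_eq_square)
    then have "rho_hat m L \<delta> \<alpha> = (b + q) * c"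
      using rho_hat_nonneg b q c(1) by (simp add: power2_eq_iff_nonneg)
    moreover have "(Re g - m) * (Re g - L) + (Im g)\<^sup>2 = 0"
      unfolding Im Re by (simp add: algebra_simps)
    ultimately show ?thesis using val by (metis order_refl)
  qed
qed

section \<open>The infimum in closed form and the recursion\<close>

lemma INF_T_set:
  assumes "0 \<le> U" "0 \<le> \<sigma>"
  shows "(INF (\<rho>, l1, l2, l3) \<in> T_set m L \<delta> \<alpha>. \<rho>\<^sup>2 * U + l2 * \<sigma>\<^sup>2)
    = (rho_hat m L \<delta> \<alpha> * sqrt U + \<sigma>)\<^sup>2"
    (is "Inf (?F ` ?T) = ?v")
proof -
  let ?r = "rho_hat m L \<delta> \<alpha>"
  have lower: "?v \<le> ?F z" if z: "z \<in> ?T" for z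
  proof -
    obtain \<rho> l1 l2 l3 where z_eq: "z = (\<rho>, l1, l2, l3)" by (cases z)
    obtain g :: complex where g: "(Re g - m) * (Re g - L) + (Im g)\<^sup>2 \<le> 0"
      "?r \<le> cmod (1 - \<alpha> * g) + \<alpha> * \<delta> * cmod g"
      using ex_worst_gradient by blast
    have "?v \<le> ((cmod (1 - \<alpha> * g) + \<alpha> * \<delta> * cmod g) * sqrt U + \<sigma>)\<^sup>2"
      using g(2) rho_hat_nonneg assms by (intro power_mono add_right_mono mult_right_mono) auto
    also have "\<dots> \<le> \<rho>\<^sup>2 * (sqrt U)\<^sup>2 + l2 * \<sigma>\<^sup>2"
      using z[unfolded z_eq] g(1) assms \<delta>_pos \<alpha>_nonneg by (intro T_set_lower_bound) auto
    finally show ?thesis using assms by (simp add: z_eq)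
  qed
  \<comment> \<open>The margin \<open>e\<close> plays two parts: it is the slack demanded by
    \<open>ex_contraction_cert\<close>, and it keeps the Young weights positive when
    \<open>U\<close> or \<open>\<sigma>\<close> is zero.\<close>
  have upper: "\<exists>z\<in>?T. ?F z \<le> ((?r + e) * sqrt U + e + (\<sigma> + e))\<^sup>2" if e: "0 < e" for e
  proof -
    obtain l1 l3 where cert: "contraction_cert m L \<delta> \<alpha> (?r + e) l1 l3"
      using ex_contraction_cert[of "?r + e"] e by auto
    define p q where "p = (?r + e) * sqrt U + e" and "q = \<sigma> + e"
    have nn: "0 \<le> (?r + e) * sqrt U"
      using rho_hat_nonneg e assms by simp
    then have pq: "0 < p" "0 < q"
      using e assms by (auto simp: p_def q_def)
    let ?z = "(sqrt ((p + q) / p) * (?r + e), (p + q) / p * l1, (p + q) / q, (p + q) / p * l3)"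
    have "?z \<in> ?T"
      using T_set_of_contraction_cert[OF cert _ pq] rho_hat_nonneg e by simp
    moreover have "?F ?z \<le> (p + q)\<^sup>2"
    proof -
      have "?F ?z = (p + q) / p * ((?r + e) * sqrt U)\<^sup>2 + (p + q) / q * \<sigma>\<^sup>2"
        using pq assms by (simp add: power_mult_distrib)
      also have "\<dots> \<le> (p + q) / p * p\<^sup>2 + (p + q) / q * q\<^sup>2"
        using pq nn assms e by (intro add_mono mult_left_mono power_mono) (auto simp: p_def q_def)
      also have "\<dots> = (p + q)\<^sup>2"
        using pq by (simp add: field_simps power2_eq_square)
      finally show ?thesis .
    qed
    ultimately show ?thesis unfolding p_def q_def by blast
  qed
  have bdd: "bdd_below (?F ` ?T)"
    using lower by (intro bdd_belowI2)
  show ?thesis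
  proof (rule antisym)
    have "Inf (?F ` ?T) \<le> ((?r + e) * sqrt U + e + (\<sigma> + e))\<^sup>2" if "0 < e" for e
      using upper[OF that] cINF_lower[OF bdd] by (meson order_trans)
    then have "\<forall>\<^sub>F e in at_right 0. Inf (?F ` ?T) \<le> ((?r + e) * sqrt U + e + (\<sigma> + e))\<^sup>2"
      by (simp add: eventually_at_right_less[THEN eventually_mono])
    moreover have "((\<lambda>e. ((?r + e) * sqrt U + e + (\<sigma> + e))\<^sup>2) \<longlongrightarrow> ((?r + 0) * sqrt U + 0 + (\<sigma> + 0))\<^sup>2)
      (at_right 0)"
      by (intro tendsto_intros)
    ultimately have "Inf (?F ` ?T) \<le> ((?r + 0) * sqrt U + 0 + (\<sigma> + 0))\<^sup>2"
      by (intro tendsto_lowerbound) auto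
    then show "Inf (?F ` ?T) \<le> ?v" by simp
    show "?v \<le> Inf (?F ` ?T)"
      \<comment> \<open>The instance of \<open>upper\<close> serves only to show that
        \<open>T_set\<close> is nonempty.\<close>
      using upper[of 1] lower by (intro cINF_greatest) auto
  qed
qed

end

theorem theorem3p4:
  fixes f :: "nat \<Rightarrow> real^'p::finite \<Rightarrow> real"
    and m L \<sigma> \<delta> \<alpha> :: "nat \<Rightarrow> real"
    and x xstar v :: "nat \<Rightarrow> real^'p"
    and U :: "nat \<Rightarrow> real"
  assumes "\<And>t. 0 < m t" and "\<And>t. m t \<le> L t"
    and "\<And>t. 0 \<le> \<sigma> t"
    and "\<And>t. 0 < \<delta> t" and "\<And>t. \<delta> t < 2 * m t / (L t + m t)"
    and "\<And>t. 0 \<le> \<alpha> t" and "\<And>t. \<alpha> t \<le> 2 / ((1 + \<delta> t) * L t)"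
    and "\<And>t. f t \<in> S_class (m t) (L t)"
    and "\<And>t. global_minimizer (f t) (xstar t)"
    and "\<And>t. x (Suc t) = x t - \<alpha> t *\<^sub>R (gradient (f t) (x t) + v t)"
    and "\<And>t. norm (xstar (Suc t) - xstar t) \<le> \<sigma> t"
    and "\<And>t. norm (v t) \<le> \<delta> t * norm (gradient (f t) (x t))"
    and "U 0 = (norm (x 0 - xstar 0))\<^sup>2"
    and "\<And>t. U (Suc t) =
           (INF (\<rho>, l1, l2, l3) \<in> T_set (m t) (L t) (\<delta> t) (\<alpha> t). \<rho>\<^sup>2 * U t + l2 * (\<sigma> t)\<^sup>2)"
  shows "\<forall>t. U (Suc t) = (rho_hat (m t) (L t) (\<delta> t) (\<alpha> t) * sqrt (U t) + \<sigma> t)\<^sup>2"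
proof
  \<comment> \<open>\<open>INF_T_set\<close> presupposes a nonnegative \<open>U t\<close>.
    Conversely it presents the next value as a square, so the induction closes.\<close>
  have U_nonneg: "0 \<le> U t" for t
  proof (induction t)
    case 0
    then show ?case by (simp add: assms(13))
  next
    case (Suc t)
    interpret step_parameters "m t" "L t" "\<delta> t" "\<alpha> t"
      using assms by unfold_locales auto
    show ?case
      unfolding assms(14) INF_T_set[OF Suc assms(3)] by simp
  qed
  fix t
  interpret step_parameters "m t" "L t" "\<delta> t" "\<alpha> t"
    using assms by unfold_locales auto
  show "U (Suc t) = (rho_hat (m t) (L t) (\<delta> t) (\<alpha> t) * sqrt (U t) + \<sigma> t)\<^sup>2"
    unfolding assms(14) by (rule INF_T_set[OF U_nonneg assms(3)])
qed

end
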